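(* Let $m\ge1$, $p\ge m$ and $0\le q\le\min(m,2p)$ be integers and let $T=\{t_i\}_{i\in\mathbb{Z}}$ be a strictly increasing sequence of knots. For every $i\in\mathbb{Z}$, the minimization problem $$\min\Big\{\|\lambda_i\|_1=\sum_{s=-p}^p|\lambda_i(s)| \;:\; \lambda_i=(\lambda_i(s))_{-p\le s\le p}\in\mathbb{R}^{2p+1},\ V_i\lambda_i=b_i\Big\}$$ has a solution. In general the solution is not unique, i.e. there are instances $(m,p,q,T,i)$ of the problem having more than one solution.
   Context: For the knot sequence $T=\{t_i\}_{i\in\mathbb{Z}}$ of $\mathbb{R}$ and degree $m$, put, for $0\le r\le m$, $\theta_i^{(r)}=\sigma_r(T_i)/\binom mr$, where $T_i=\{t_{i-k}:0\le k\le m-1\}$, $\sigma_0(T_i)=1$ and $\sigma_r(T_i)=\sum_{0\le k_1<\dots<k_r\le m-1}t_{i-k_1}\cdots t_{i-k_r}$ for $1\le r\le m$. Let $\theta_i=\theta_i^{(1)}=\frac1m\sum_{k=0}^{m-1}t_{i-k}$. $V_i\in\mathbb{R}^{(q+1)\times(2p+1)}$ is the matrix with entries $V_i(r,s)=\theta_{i+s}^{\,r}$ (ordinary $r$-th power of $\theta_{i+s}$, with zeroth power $1$), $0\le r\le q$, $-p\le s\le p$, and $b_i\in\mathbb{R}^{q+1}$ is the vector with components $b_i(r)=\theta_i^{(r)}$, $0\le r\le q$. (The constraint $V_i\lambda_i=b_i$ for all $i$ expresses that the discrete quasi-interpolant $Qf=\sum_{i\in\mathbb{Z}}\big(\sum_{s=-p}^p\lambda_i(s)f(\theta_{i+s})\big)B_i$,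 with $B_i$ the normalized degree-$m$ B-splines with support $[t_{i-m},t_{i+1}]$, reproduces all polynomials of degree at most $q$.) *)

theory Defs
  imports Complex_Main "Jordan_Normal_Form.Matrix"
begin

text \<open>A strictly increasing tuple \<open>k\<^sub>1 < \<dots> < k\<^sub>r\<close> of indices below \<open>m\<close> is encoded by the
  \<open>r\<close>-element set \<open>K\<close> of its entries; for \<open>r = 0\<close> the sum is the empty product, i.e. 1.\<close>

definition knot_sigma :: "(int \<Rightarrow> real) \<Rightarrow> nat \<Rightarrow> nat \<Rightarrow> int \<Rightarrow> real" where
  "knot_sigma t m r i = (\<Sum>K | K \<subseteq> {..<m} \<and> card K = r. \<Prod>k\<in>K. t (i - int k))"

definition theta_sym :: "(int \<Rightarrow> real) \<Rightarrow> nat \<Rightarrow> nat \<Rightarrow> int \<Rightarrow> real" where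
  "theta_sym t m r i = knot_sigma t m r i / real (m choose r)"

definition theta :: "(int \<Rightarrow> real) \<Rightarrow> nat \<Rightarrow> int \<Rightarrow> real" where
  "theta t m i = (\<Sum>k<m. t (i - int k)) / real m"

lemma knot_sigma_0: "knot_sigma t m 0 i = 1"
proof -
  have "{K. K \<subseteq> {..<m} \<and> card K = 0} = {{}}"
    by (auto dest: finite_subset)
  then show ?thesis
    by (simp add: knot_sigma_def)
qed

lemma theta_sym_1: "theta_sym t m 1 i = theta t m i"
proof -
  have "{K. K \<subseteq> {..<m} \<and> card K = 1} = (\<lambda>k. {k}) ` {..<m}"
    by (auto simp: card_1_singleton_iff)
  then show ?thesis
    by (simp add: theta_sym_def knot_sigma_def theta_def sum.reindex)
qed

text \<open>Columns are numbered from 0 in the matrix library: column \<open>j\<close> of the matrix and entry \<open>j\<close>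
  of a coefficient vector stand for the index \<open>s = j - p\<close> in \<open>{-p..p}\<close>.\<close>

definition V_mat :: "(int \<Rightarrow> real) \<Rightarrow> nat \<Rightarrow> nat \<Rightarrow> nat \<Rightarrow> int \<Rightarrow> real mat" where
  "V_mat t m p q i = mat (q + 1) (2 * p + 1) (\<lambda>(r, j). theta t m (i + (int j - int p)) ^ r)"

definition b_vec :: "(int \<Rightarrow> real) \<Rightarrow> nat \<Rightarrow> nat \<Rightarrow> int \<Rightarrow> real vec" where
  "b_vec t m q i = vec (q + 1) (\<lambda>r. theta_sym t m r i)"

definition feasible :: "(int \<Rightarrow> real) \<Rightarrow> nat \<Rightarrow> nat \<Rightarrow> nat \<Rightarrow> int \<Rightarrow> real vec set" where
  "feasible t m p q i = {x \<in> carrier_vec (2 * p + 1). V_mat t m p q i *\<^sub>v x = b_vec t m q i}"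

definition l1_norm :: "real vec \<Rightarrow> real" where
  "l1_norm x = (\<Sum>j<dim_vec x. \<bar>x $ j\<bar>)"

definition is_solution :: "(int \<Rightarrow> real) \<Rightarrow> nat \<Rightarrow> nat \<Rightarrow> nat \<Rightarrow> int \<Rightarrow> real vec \<Rightarrow> bool" where
  "is_solution t m p q i x \<longleftrightarrow> is_arg_min l1_norm (\<lambda>y. y \<in> feasible t m p q i) x"

end

theory Submission
  imports Defs "HOL-Analysis.Function_Topology"
begin

text \<open>
  Existence. The quasi-interpolation nodes \<open>\<theta>\<^sub>j\<close> increase strictly with the knots, so \<open>V\<^sub>i\<close> is a
  Vandermonde matrix on \<open>2p + 1 \<ge> q + 1\<close> distinct nodes. Its rows are independent, and the affine
  system is solvable for every right-hand side (\<open>moment_problem_solvable\<close>). On the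
  nonempty feasible set the \<open>\<ell>\<^sup>1\<close> norm attains its infimum, because the part of the set inside a
  large enough box is compact (\<open>affine_l1_minimizer\<close>).

  Non-uniqueness. The constraint with \<open>r = 0\<close> says that the coefficients sum to 1, so that
  every feasible vector has norm at least 1, and all nonnegative feasible vectors are solutions. With
  knots at the integers and \<open>m = p = q = 1\<close>, reproducing affine functions at a node can be done
  either by evaluating at that node or by averaging over its two neighbours. Both are nonnegative.
\<close>

text \<open>A Vandermonde system is solved by adding one node \<open>x\<^sub>a\<close> at a time. If
  \<open>S\<^sub>r = \<Sum>\<^sub>j w\<^sub>j x\<^sub>j\<^sup>r\<close>, then \<open>S\<^bsub>r+1\<^esub> - x\<^sub>a S\<^sub>r\<close> no longer involves node \<open>a\<close>. The weights of
  the other nodes are therefore determined, up to division by \<open>x\<^sub>j - x\<^sub>a\<close>, by the moment problem for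
  the shorter sequence \<open>b\<^bsub>r+1\<^esub> - x\<^sub>a b\<^sub>r\<close>, and \<open>w\<^sub>a\<close> serves to adjust the zeroth moment.\<close>

lemma moment_problem_solvable:
  fixes x :: "'a \<Rightarrow> 'b::field" and b :: "nat \<Rightarrow> 'b"
  assumes "finite A" and "inj_on x A"
  shows "\<exists>w. \<forall>r<card A. (\<Sum>j\<in>A. x j ^ r * w j) = b r"
  using assms
proof (induction A arbitrary: b rule: finite_induct)
  case empty
  then show ?case by simp
next
  case (insert a A)
  obtain u where u: "\<And>r. r < card A \<Longrightarrow> (\<Sum>j\<in>A. x j ^ r * u j) = b (Suc r) - x a * b r"
    using insert.IH[of "\<lambda>r. b (Suc r) - x a * b r"] insert.prems by (auto simp: inj_on_def)
  define v where "v j = u j / (x j - x a)" for j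
  define w where "w = v(a := b 0 - (\<Sum>j\<in>A. v j))"
  have w_on_A: "w j = v j" if "j \<in> A" for j
    using that insert.hyps by (auto simp: w_def)
  have sum_w: "(\<Sum>j\<in>insert a A. x j ^ r * w j) = x a ^ r * w a + (\<Sum>j\<in>A. x j ^ r * v j)" for r
    using insert.hyps w_on_A by simp
  have v_u: "x j * v j - x a * v j = u j" if "j \<in> A" for j
  proof -
    have "x j \<noteq> x a"
      using insert.prems insert.hyps that by (auto simp: inj_on_def)
    then show ?thesis
      by (simp add: v_def divide_simps) (simp add: algebra_simps)
  qed
  have "(\<Sum>j\<in>insert a A. x j ^ r * w j) = b r" if "r < card (insert a A)" for r
    using that
  proof (induction r)
    case 0
    show ?case by (subst sum_w) (simp add: w_def)
  next
    case (Suc r)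
    have "(\<Sum>j\<in>A. x j ^ Suc r * v j) - x a * (\<Sum>j\<in>A. x j ^ r * v j)
        = (\<Sum>j\<in>A. x j ^ r * (x j * v j - x a * v j))"
      by (simp add: sum_distrib_left sum_subtractf algebra_simps)
    also have "\<dots> = (\<Sum>j\<in>A. x j ^ r * u j)"
      using v_u by simp
    also have "\<dots> = b (Suc r) - x a * b r"
      using Suc.prems insert.hyps by (intro u) simp
    finally have "(\<Sum>j\<in>A. x j ^ Suc r * v j) = b (Suc r) - x a * b r + x a * (\<Sum>j\<in>A. x j ^ r * v j)"
      by (simp add: algebra_simps)
    moreover have "b r = x a ^ r * w a + (\<Sum>j\<in>A. x j ^ r * v j)"
      using Suc sum_w by simp
    ultimately show ?case
      by (subst sum_w) (simp add: algebra_simps)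
  qed
  then show ?case by blast
qed

text \<open>Cutting a function off to 0 outside \<open>J\<close> changes neither the constraints nor the norm, so the
  search may be confined to functions vanishing there, among which boxes are compact by Tychonoff's
  theorem. The box \<open>K\<close> has as its radius the norm of one feasible vector; a feasible vector outside it
  has a larger norm and cannot compete.\<close>

lemma affine_l1_minimizer:
  fixes a :: "'r \<Rightarrow> 'a \<Rightarrow> real"
  assumes "finite J" and feas: "\<exists>x. \<forall>r\<in>R. (\<Sum>j\<in>J. a r j * x j) = b r"
  shows "\<exists>x. (\<forall>r\<in>R. (\<Sum>j\<in>J. a r j * x j) = b r) \<and>
             (\<forall>y. (\<forall>r\<in>R. (\<Sum>j\<in>J. a r j * y j) = b r) \<longrightarrow> (\<Sum>j\<in>J. \<bar>x j\<bar>) \<le> (\<Sum>j\<in>J. \<bar>y j\<bar>))"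
proof -
  define F where "F = {x. \<forall>r\<in>R. (\<Sum>j\<in>J. a r j * x j) = b r}"
  define nrm where "nrm x = (\<Sum>j\<in>J. \<bar>x j\<bar>)" for x :: "'a \<Rightarrow> real"
  obtain z where z: "z \<in> F"
    using feas by (auto simp: F_def)
  define K where "K = (\<Pi>\<^sub>E j\<in>UNIV. if j \<in> J then {- nrm z..nrm z} else {0})"
  define cut where "cut y = (\<lambda>j. if j \<in> J then y j else 0)" for y :: "'a \<Rightarrow> real"
  have cut_F: "cut y \<in> F" if "y \<in> F" for y
    using that by (simp add: F_def cut_def)
  have cut_nrm: "nrm (cut y) = nrm y" for y
    by (simp add: nrm_def cut_def)
  have cut_K: "cut y \<in> K" if "nrm y \<le> nrm z" for y
  proof -
    have "\<bar>y j\<bar> \<le> nrm z" if "j \<in> J" for j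
    proof -
      have "\<bar>y j\<bar> \<le> nrm y"
        unfolding nrm_def using that \<open>finite J\<close> by (intro member_le_sum) auto
      then show ?thesis using \<open>nrm y \<le> nrm z\<close> by simp
    qed
    then show ?thesis
      by (fastforce simp: K_def cut_def abs_le_iff)
  qed
  have "compactin (product_topology (\<lambda>j. euclidean) UNIV) K"
    unfolding K_def compactin_PiE by simp
  then have "compact K"
    by (simp add: euclidean_product_topology)
  moreover have "closed F"
  proof -
    have "F = (\<Inter>r\<in>R. {x. (\<Sum>j\<in>J. a r j * x j) = b r})"
      by (auto simp: F_def)
    then show ?thesis
      by (auto intro!: closed_INT closed_Collect_eq continuous_intros)
  qed
  ultimately have "compact (K \<inter> F)"
    by (rule compact_Int_closed)
  moreover have "cut z \<in> K \<inter> F"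
    using cut_F[OF z] cut_K[of z] by simp
  moreover have "continuous_on (K \<inter> F) nrm"
    unfolding nrm_def by (intro continuous_intros continuous_on_product_coordinates[THEN continuous_on_subset]) auto
  ultimately obtain x where x: "x \<in> K \<inter> F" and least: "\<And>y. y \<in> K \<inter> F \<Longrightarrow> nrm x \<le> nrm y"
    using continuous_attains_inf[of "K \<inter> F" nrm] by blast
  have "nrm x \<le> nrm y" if "y \<in> F" for y
  proof (cases "nrm y \<le> nrm z")
    case True
    then show ?thesis
      using least[of "cut y"] cut_F[OF that] cut_K[of y] by (simp add: cut_nrm)
  next
    case False
    moreover have "nrm x \<le> nrm z"
      using least[OF \<open>cut z \<in> K \<inter> F\<close>] by (simp add: cut_nrm)
    ultimately show ?thesis by simp
  qed
  with x show ?thesis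
    unfolding F_def nrm_def by blast
qed

lemma theta_strict_mono:
  assumes "strict_mono t" and "0 < m"
  shows "strict_mono (theta t m)"
proof (rule strict_monoI)
  fix i j :: int
  assume "i < j"
  then have "(\<Sum>k<m. t (i - int k)) < (\<Sum>k<m. t (j - int k))"
    using assms by (intro sum_strict_mono) (auto intro: strict_monoD)
  then show "theta t m i < theta t m j"
    using \<open>0 < m\<close> by (simp add: theta_def divide_strict_right_mono)
qed

lemma vec_in_feasible_iff:
  "vec (2 * p + 1) x \<in> feasible t m p q i \<longleftrightarrow>
     (\<forall>r\<in>{..q}. (\<Sum>j<2 * p + 1. theta t m (i + (int j - int p)) ^ r * x j) = theta_sym t m r i)"
proof -
  have "(V_mat t m p q i *\<^sub>v vec (2 * p + 1) x) $ r
      = (\<Sum>j<2 * p + 1. theta t m (i + (int j - int p)) ^ r * x j)" if "r < q + 1" for r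
    using that by (simp add: V_mat_def scalar_prod_def lessThan_atLeast0)
  moreover have "dim_vec (V_mat t m p q i *\<^sub>v vec (2 * p + 1) x) = q + 1"
    by (simp add: V_mat_def)
  ultimately show ?thesis
    by (auto simp: feasible_def b_vec_def vec_eq_iff less_Suc_eq_le)
qed

lemma feasible_is_vec:
  assumes "y \<in> feasible t m p q i"
  shows "y = vec (2 * p + 1) (($) y)"
  using assms by (intro eq_vecI) (auto simp: feasible_def)

lemma l1_norm_vec: "l1_norm (vec n x) = (\<Sum>j<n. \<bar>x j\<bar>)"
  by (simp add: l1_norm_def)

lemma solution_exists:
  assumes "strict_mono t" and "0 < m" and "q \<le> 2 * p"
  shows "\<exists>x. is_solution t m p q i x"
proof -
  let ?a = "\<lambda>r j. theta t m (i + (int j - int p)) ^ r"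
  have "inj_on (\<lambda>j. theta t m (i + (int j - int p))) {..<2 * p + 1}"
    using strict_mono_eq[OF theta_strict_mono[OF assms(1,2)]] by (auto intro!: inj_onI)
  \<comment> \<open>All \<open>2p + 1\<close> moments can be prescribed; only the first \<open>q + 1\<close> of them are constrained.\<close>
  then obtain w where w: "\<forall>r<2 * p + 1. (\<Sum>j<2 * p + 1. ?a r j * w j) = theta_sym t m r i"
    using moment_problem_solvable[OF finite_lessThan, of _ "2 * p + 1" "\<lambda>r. theta_sym t m r i"]
    unfolding card_lessThan by blast
  have "\<exists>w. \<forall>r\<in>{..q}. (\<Sum>j<2 * p + 1. ?a r j * w j) = theta_sym t m r i"
    using w \<open>q \<le> 2 * p\<close> by (intro exI[of _ w]) auto
  then obtain x where
    x: "\<forall>r\<in>{..q}. (\<Sum>j<2 * p + 1. ?a r j * x j) = theta_sym t m r i" and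
    least: "\<And>y. \<forall>r\<in>{..q}. (\<Sum>j<2 * p + 1. ?a r j * y j) = theta_sym t m r i \<Longrightarrow>
      (\<Sum>j<2 * p + 1. \<bar>x j\<bar>) \<le> (\<Sum>j<2 * p + 1. \<bar>y j\<bar>)"
    using affine_l1_minimizer[of "{..<2 * p + 1}" "{..q}" ?a "\<lambda>r. theta_sym t m r i"] by blast
  have "l1_norm (vec (2 * p + 1) x) \<le> l1_norm y" if y: "y \<in> feasible t m p q i" for y
  proof -
    have "vec (2 * p + 1) (($) y) \<in> feasible t m p q i"
      using y feasible_is_vec by metis
    then have "l1_norm (vec (2 * p + 1) x) \<le> l1_norm (vec (2 * p + 1) (($) y))"
      unfolding vec_in_feasible_iff l1_norm_vec by (rule least)
    then show ?thesis
      using feasible_is_vec[OF y] by simp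
  qed
  moreover have "vec (2 * p + 1) x \<in> feasible t m p q i"
    using x by (simp only: vec_in_feasible_iff)
  ultimately have "is_solution t m p q i (vec (2 * p + 1) x)"
    unfolding is_solution_def is_arg_min_linorder by blast
  then show ?thesis ..
qed

text \<open>Reproduction of constants makes the coefficients sum to 1.\<close>

lemma one_le_l1_norm_feasible:
  assumes "y \<in> feasible t m p q i"
  shows "1 \<le> l1_norm y"
proof -
  have "vec (2 * p + 1) (($) y) \<in> feasible t m p q i"
    using assms feasible_is_vec by metis
  then have "(\<Sum>j<2 * p + 1. y $ j) = theta_sym t m 0 i"
    unfolding vec_in_feasible_iff by (metis (no_types, lifting) atMost_iff le0 mult_1 power_0 sum.cong)
  also have "\<dots> = 1"
    by (simp add: theta_sym_def knot_sigma_0)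
  finally have "1 \<le> (\<Sum>j<2 * p + 1. \<bar>y $ j\<bar>)"
    using sum_abs[of "($) y" "{..<2 * p + 1}"] by linarith
  then have "1 \<le> l1_norm (vec (2 * p + 1) (($) y))"
    by (simp only: l1_norm_vec)
  then show ?thesis
    using feasible_is_vec[OF assms] by simp
qed

lemma feasible_l1_norm_one_is_solution:
  assumes "x \<in> feasible t m p q i" and "l1_norm x = 1"
  shows "is_solution t m p q i x"
  using assms by (auto simp: is_solution_def is_arg_min_linorder one_le_l1_norm_feasible)

text \<open>With degree 1 and integer knots the nodes are \<open>\<theta>\<^sub>j = j\<close>. Vector entries 0, 1, 2 belong
  to the nodes -1, 0, 1, so \<open>e\<close> evaluates at the middle node and \<open>h\<close> averages over the outer two.\<close>

lemma two_solutions_integer_knots: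
  defines "e \<equiv> vec 3 (\<lambda>j. if j = 1 then 1 else 0)"
    and "h \<equiv> vec 3 (\<lambda>j. if j = 1 then 0 else 1 / 2)"
  shows "is_solution real_of_int 1 1 1 0 e" and "is_solution real_of_int 1 1 1 0 h" and "e \<noteq> h"
proof -
  have theta_id: "theta real_of_int 1 j = j" for j
    by (simp add: theta_def)
  have rhs: "theta_sym real_of_int 1 0 0 = 1" "theta_sym real_of_int 1 1 0 = 0"
    by (simp_all only: theta_sym_1 theta_id) (simp_all add: theta_sym_def knot_sigma_0)
  have feas_iff: "vec 3 x \<in> feasible real_of_int 1 1 1 0 \<longleftrightarrow> x 0 + x 1 + x 2 = 1 \<and> x 2 = x 0" for x
  proof -
    have three: "2 * 1 + 1 = (3 :: nat)" and le_1: "{..1::nat} = {0, 1}" and lt_3: "{..<3::nat} = {0, 1, 2}"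
      by auto
    show ?thesis
      using vec_in_feasible_iff[of 1 x real_of_int 1 1 0]
      unfolding three le_1 lt_3 theta_id by (auto simp: rhs[unfolded One_nat_def])
  qed
  have norm: "l1_norm (vec 3 x) = \<bar>x 0\<bar> + \<bar>x 1\<bar> + \<bar>x 2\<bar>" for x
    by (simp add: l1_norm_vec numeral_3_eq_3 numeral_2_eq_2)
  show "is_solution real_of_int 1 1 1 0 e"
    unfolding e_def by (rule feasible_l1_norm_one_is_solution) (simp_all add: feas_iff[unfolded One_nat_def] norm)
  show "is_solution real_of_int 1 1 1 0 h"
    unfolding h_def by (rule feasible_l1_norm_one_is_solution) (simp_all add: feas_iff[unfolded One_nat_def] norm)
  have "e $ 1 \<noteq> h $ 1"
    by (simp add: e_def h_def)
  then show "e \<noteq> h" by auto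
qed

theorem theorem3:
  shows "(\<forall>(m::nat) (p::nat) (q::nat) (t :: int \<Rightarrow> real).
            1 \<le> m \<and> m \<le> p \<and> q \<le> min m (2 * p) \<and> strict_mono t \<longrightarrow>
            (\<forall>i::int. \<exists>x. is_solution t m p q i x))
       \<and> (\<exists>(m::nat) (p::nat) (q::nat) (t :: int \<Rightarrow> real) (i::int).
            1 \<le> m \<and> m \<le> p \<and> q \<le> min m (2 * p) \<and> strict_mono t \<and>
            (\<exists>x y. is_solution t m p q i x \<and> is_solution t m p q i y \<and> x \<noteq> y))"
proof
  show "\<forall>(m::nat) (p::nat) (q::nat) (t :: int \<Rightarrow> real).
            1 \<le> m \<and> m \<le> p \<and> q \<le> min m (2 * p) \<and> strict_mono t \<longrightarrow>
            (\<forall>i::int. \<exists>x. is_solution t m p q i x)"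
    by (auto intro: solution_exists)
  have "strict_mono real_of_int"
    by (rule strict_monoI) simp
  moreover have "(1::nat) \<le> 1" "(1::nat) \<le> min 1 (2 * 1)"
    by simp_all
  ultimately show "\<exists>(m::nat) (p::nat) (q::nat) (t :: int \<Rightarrow> real) (i::int).
            1 \<le> m \<and> m \<le> p \<and> q \<le> min m (2 * p) \<and> strict_mono t \<and>
            (\<exists>x y. is_solution t m p q i x \<and> is_solution t m p q i y \<and> x \<noteq> y)"
    using two_solutions_integer_knots by blast
qed

end
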